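(* Let $F$ be a forest with domination number $\gamma$. Then $F$ has at most $\sqrt{5}^{\,\gamma}$ minimum dominating sets, i.e. $\Gamma(F)\le \sqrt{5}^{\,\gamma}$.
   Context: For a graph $G$, a set $D\subseteq V(G)$ is dominating if every vertex of $G$ lies in $D$ or has a neighbour in $D$. The domination number $\gamma(G)$ is the minimum size of a dominating set; a dominating set of size $\gamma(G)$ is a minimum dominating set. $\Gamma(G)$ denotes the number of minimum dominating sets of $G$. *)

theory Defs
  imports Complex_Main
begin

definition simple_graph :: "'a set \<Rightarrow> 'a set set \<Rightarrow> bool" where
  "simple_graph V E \<longleftrightarrow> finite V \<and> (\<forall>e\<in>E. e \<subseteq> V \<and> card e = 2)"

definition is_cycle :: "'a set \<Rightarrow> 'a set set \<Rightarrow> 'a list \<Rightarrow> bool" where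
  "is_cycle V E c \<longleftrightarrow> length c \<ge> 3 \<and> distinct c \<and> set c \<subseteq> V \<and>
     (\<forall>i < length c - 1. {c ! i, c ! Suc i} \<in> E) \<and> {last c, hd c} \<in> E"

definition forest :: "'a set \<Rightarrow> 'a set set \<Rightarrow> bool" where
  "forest V E \<longleftrightarrow> simple_graph V E \<and> (\<nexists>c. is_cycle V E c)"

definition dominating :: "'a set \<Rightarrow> 'a set set \<Rightarrow> 'a set \<Rightarrow> bool" where
  "dominating V E D \<longleftrightarrow> D \<subseteq> V \<and> (\<forall>v\<in>V. v \<in> D \<or> (\<exists>u\<in>D. {u, v} \<in> E))"

definition domination_number :: "'a set \<Rightarrow> 'a set set \<Rightarrow> nat" where
  "domination_number V E = (LEAST k. \<exists>D. dominating V E D \<and> card D = k)"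

definition min_dom_sets :: "'a set \<Rightarrow> 'a set set \<Rightarrow> 'a set set" where
  "min_dom_sets V E = {D. dominating V E D \<and> card D = domination_number V E}"

end

theory Submission
  imports Defs
begin

text \<open>Root the forest and sort the sets dominating every vertex except possibly the root into three
  families: those containing the root, those dominating it from a neighbour, and those leaving it
  undominated. Joining two rooted forests by an edge between their roots acts on the size-indexed
  counts of these families by convolution, and only the counts at the least relevant sizes can
  contribute to minimum dominating sets. Divided by the appropriate power of \<open>sqrt 5\<close>, these triples
  of counts always lie below one of 21 explicit triples, a list that is closed under joining;
  each triple in it respects the bound. Every forest arises by joining at edges and adding
  isolated roots.\<close>

section \<open>Counting subsets by size\<close>

definition count :: "'a set \<Rightarrow> ('a set \<Rightarrow> bool) \<Rightarrow> nat \<Rightarrow> nat" where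
  "count V P k = card {D. D \<subseteq> V \<and> P D \<and> card D = k}"

text \<open>Cauchy product: \<open>count V P\<close> is treated as the coefficient sequence of a
  generating polynomial by size, so independent choices on disjoint vertex sets multiply.\<close>

definition conv :: "(nat \<Rightarrow> nat) \<Rightarrow> (nat \<Rightarrow> nat) \<Rightarrow> nat \<Rightarrow> nat" where
  "conv f g k = (\<Sum>j\<le>k. f j * g (k - j))"

lemma count_cong: "(\<And>D. D \<subseteq> V \<Longrightarrow> P D = Q D) \<Longrightarrow> count V P = count V Q"
  by (rule ext) (auto simp: count_def intro!: arg_cong[where f = card])

lemma count_disj:
  assumes "finite V" "\<And>D. \<not> (P D \<and> Q D)"
  shows "count V (\<lambda>D. P D \<or> Q D) k = count V P k + count V Q k"
proof -
  have "{D. D \<subseteq> V \<and> (P D \<or> Q D) \<and> card D = k} =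
      {D. D \<subseteq> V \<and> P D \<and> card D = k} \<union> {D. D \<subseteq> V \<and> Q D \<and> card D = k}" by auto
  moreover have "finite {D. D \<subseteq> V \<and> R D \<and> card D = k}" for R
    by (rule finite_subset[of _ "Pow V"]) (use assms in auto)
  moreover have "{D. D \<subseteq> V \<and> P D \<and> card D = k} \<inter> {D. D \<subseteq> V \<and> Q D \<and> card D = k} = {}"
    using assms(2) by auto
  ultimately show ?thesis unfolding count_def by (simp add: card_Un_disjoint)
qed

text \<open>A set splits uniquely into its traces on \<open>V1\<close> and \<open>V2\<close>, whose
  sizes add; summing over the size of the first trace gives the convolution.\<close>

lemma count_split:
  assumes "finite V1" "finite V2" "V1 \<inter> V2 = {}"
  shows "count (V1 \<union> V2) (\<lambda>D. P (D \<inter> V1) \<and> Q (D \<inter> V2)) = conv (count V1 P) (count V2 Q)"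
proof
  fix k
  define A where "A j = {D. D \<subseteq> V1 \<and> P D \<and> card D = j}" for j
  define B where "B j = {D. D \<subseteq> V2 \<and> Q D \<and> card D = j}" for j
  define S where "S = (SIGMA j:{..k}. A j \<times> B (k - j))"
  have fin: "finite (A j)" "finite (B j)" for j
    using assms by (auto simp: A_def B_def intro: finite_subset[of _ "Pow V1"] finite_subset[of _ "Pow V2"])
  have bij: "bij_betw (\<lambda>(j, D1, D2). D1 \<union> D2) S
      {D. D \<subseteq> V1 \<union> V2 \<and> (P (D \<inter> V1) \<and> Q (D \<inter> V2)) \<and> card D = k}"
  proof (rule bij_betw_byWitness[where f' = "\<lambda>D. (card (D \<inter> V1), D \<inter> V1, D \<inter> V2)"])
    have eq: "(D1 \<union> D2) \<inter> V1 = D1" "(D1 \<union> D2) \<inter> V2 = D2" "card (D1 \<union> D2) = card D1 + card D2"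
      if "D1 \<subseteq> V1" "D2 \<subseteq> V2" for D1 D2
    proof -
      show "(D1 \<union> D2) \<inter> V1 = D1" "(D1 \<union> D2) \<inter> V2 = D2" using that assms by auto
      show "card (D1 \<union> D2) = card D1 + card D2"
        by (rule card_Un_disjoint) (use that assms in \<open>auto dest: finite_subset\<close>)
    qed
    show "\<forall>a\<in>S. (\<lambda>D. (card (D \<inter> V1), D \<inter> V1, D \<inter> V2)) ((\<lambda>(j, D1, D2). D1 \<union> D2) a) = a"
      by (auto simp: S_def A_def B_def eq)
    show "\<forall>D\<in>{D. D \<subseteq> V1 \<union> V2 \<and> (P (D \<inter> V1) \<and> Q (D \<inter> V2)) \<and> card D = k}.
        (\<lambda>(j, D1, D2). D1 \<union> D2) (card (D \<inter> V1), D \<inter> V1, D \<inter> V2) = D"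
      by auto
    show "(\<lambda>(j, D1, D2). D1 \<union> D2) ` S
        \<subseteq> {D. D \<subseteq> V1 \<union> V2 \<and> (P (D \<inter> V1) \<and> Q (D \<inter> V2)) \<and> card D = k}"
      by (auto simp: S_def A_def B_def eq)
    have "card D = card (D \<inter> V1) + card (D \<inter> V2)" if "D \<subseteq> V1 \<union> V2" for D
      using eq(3)[of "D \<inter> V1" "D \<inter> V2"] that by (simp add: Int_Un_distrib[symmetric] Int_absorb2)
    then show "(\<lambda>D. (card (D \<inter> V1), D \<inter> V1, D \<inter> V2)) `
        {D. D \<subseteq> V1 \<union> V2 \<and> (P (D \<inter> V1) \<and> Q (D \<inter> V2)) \<and> card D = k} \<subseteq> S"
      by (auto simp: S_def A_def B_def)
  qed
  have "count (V1 \<union> V2) (\<lambda>D. P (D \<inter> V1) \<and> Q (D \<inter> V2)) k = card S"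
    using bij_betw_same_card[OF bij] by (simp add: count_def)
  also have "\<dots> = (\<Sum>j\<le>k. card (A j \<times> B (k - j)))"
    unfolding S_def by (subst card_SigmaI) (use fin in auto)
  also have "\<dots> = conv (count V1 P) (count V2 Q) k"
    by (simp add: conv_def count_def A_def B_def card_cartesian_product)
  finally show "count (V1 \<union> V2) (\<lambda>D. P (D \<inter> V1) \<and> Q (D \<inter> V2)) k = conv (count V1 P) (count V2 Q) k" .
qed

section \<open>Lowest terms of a convolution\<close>

lemma conv_eq_0:
  assumes "\<And>j. j < p \<Longrightarrow> f j = 0" "\<And>j. j < q \<Longrightarrow> g j = 0" "k < p + q"
  shows "conv f g k = 0"
proof -
  have "f j * g (k - j) = 0" if "j \<le> k" for j
  proof (cases "j < p")
    case False
    then have "k - j < q" using that assms(3) by linarith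
    then show ?thesis using assms by simp
  qed (use assms in simp)
  then show ?thesis by (simp add: conv_def)
qed

text \<open>For \<open>j \<noteq> p\<close> one factor is below its threshold: either
  \<open>j < p\<close>, or \<open>j > p\<close> and then \<open>k - j < q\<close>.\<close>

lemma conv_lowest:
  assumes "\<And>j. j < p \<Longrightarrow> f j = 0" "\<And>j. j < q \<Longrightarrow> g j = 0" "k = p + q"
  shows "conv f g k = f p * g q"
proof -
  have "f j * g (k - j) = 0" if "j \<le> k" "j \<noteq> p" for j
  proof (cases "j < p")
    case False
    then have "k - j < q" using that assms(3) by linarith
    then show ?thesis using assms by simp
  qed (use assms in simp)
  then have "conv f g k = (\<Sum>j\<in>{p}. f j * g (k - j))"
    unfolding conv_def by (intro sum.mono_neutral_right) (use assms in auto)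
  then show ?thesis using assms by simp
qed

section \<open>Rooted forests\<close>

definition near_dom :: "'a set \<Rightarrow> 'a set set \<Rightarrow> 'a \<Rightarrow> 'a set \<Rightarrow> bool" where
  "near_dom V E r D \<longleftrightarrow> (\<forall>v\<in>V - {r}. v \<in> D \<or> (\<exists>u\<in>D. {u, v} \<in> E))"

definition in_sets :: "'a set \<Rightarrow> 'a set set \<Rightarrow> 'a \<Rightarrow> 'a set \<Rightarrow> bool" where
  "in_sets V E r D \<longleftrightarrow> near_dom V E r D \<and> r \<in> D"

definition dom_sets :: "'a set \<Rightarrow> 'a set set \<Rightarrow> 'a \<Rightarrow> 'a set \<Rightarrow> bool" where
  "dom_sets V E r D \<longleftrightarrow> near_dom V E r D \<and> r \<notin> D \<and> (\<exists>u\<in>D. {u, r} \<in> E)"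

definition un_sets :: "'a set \<Rightarrow> 'a set set \<Rightarrow> 'a \<Rightarrow> 'a set \<Rightarrow> bool" where
  "un_sets V E r D \<longleftrightarrow> near_dom V E r D \<and> r \<notin> D \<and> \<not> (\<exists>u\<in>D. {u, r} \<in> E)"

text \<open>With \<open>n + 1\<close> the least size of a set containing the root, the kind records which of the
  three families matter at which size. A set not containing the root may be exchanged for one that
  does, and one leaving it undominated for one that dominates it, so it is irrelevant when it is
  strictly larger than these. Adding the root shows that no set has fewer than \<open>n\<close> elements.\<close>

datatype kind = Needy | Even | Rich

text \<open>With \<open>i + d\<close> counting dominating sets, the least dominating size is
  \<open>Suc n\<close>, with count \<open>a + b\<close>, for \<open>Needy\<close> and
  \<open>Even\<close>; for \<open>Rich\<close> it is \<open>n\<close>, with count \<open>b\<close>.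
  The positivity clauses make these sizes exact and keep the kind determined under
  attaching.\<close>

definition profile :: "kind \<Rightarrow> nat \<Rightarrow> (nat \<Rightarrow> nat) \<Rightarrow> (nat \<Rightarrow> nat) \<Rightarrow> (nat \<Rightarrow> nat) \<Rightarrow> nat \<times> nat \<times> nat \<Rightarrow> bool" where
  "profile X n i d u = (\<lambda>(a, b, c). (\<forall>k\<le>n. i k = 0) \<and> (\<forall>k<n. d k = 0 \<and> u k = 0) \<and> i (Suc n) = a \<and> a > 0 \<and>
    (case X of
      Needy \<Rightarrow> d n = 0 \<and> d (Suc n) = b \<and> u n = c \<and> c > 0
    | Even \<Rightarrow> d n = 0 \<and> u n = 0 \<and> d (Suc n) = b \<and> u (Suc n) = c
    | Rich \<Rightarrow> d n = b \<and> b > 0 \<and> u n = c))"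

fun attach_kind :: "kind \<Rightarrow> kind \<Rightarrow> kind" where
  "attach_kind Needy Needy = Even"
| "attach_kind Needy Even = Rich"
| "attach_kind Needy Rich = Needy"
| "attach_kind Even Y = Even"
| "attach_kind Rich Needy = Even"
| "attach_kind Rich Even = Rich"
| "attach_kind Rich Rich = Rich"

text \<open>Leading terms of the joining rules: \<open>i * (i' + d' + u')\<close> with the root
  chosen, \<open>d * (i' + d') + u * i'\<close> with it dominated, \<open>u * d'\<close> with it
  undominated. Products at sizes above those tracked by \<open>attach_kind\<close> are dropped,
  hence the zeros. The semiring is left open so that the rules act on natural counts and on integer
  table entries alike.\<close>

fun attach :: "kind \<Rightarrow> kind \<Rightarrow> 'b::comm_semiring_1 \<times> 'b \<times> 'b \<Rightarrow> 'b \<times> 'b \<times> 'b \<Rightarrow> 'b \<times> 'b \<times> 'b" where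
  "attach Needy Needy (a, b, c) (x, y, z) = (a * z, c * x, c * y)"
| "attach Needy Even (a, b, c) (x, y, z) = (a * (x + y + z), c * x, c * y)"
| "attach Needy Rich (a, b, c) (x, y, z) = (a * (y + z), b * y + c * x, c * y)"
| "attach Even Needy (a, b, c) (x, y, z) = (a * z, 0, 0)"
| "attach Even Even (a, b, c) (x, y, z) = (a * (x + y + z), b * (x + y) + c * x, c * y)"
| "attach Even Rich (a, b, c) (x, y, z) = (a * (y + z), b * y, c * y)"
| "attach Rich Needy (a, b, c) (x, y, z) = (a * z, b * (x + y) + c * x, c * y)"
| "attach Rich Even (a, b, c) (x, y, z) = (a * (x + y + z), b * (x + y) + c * x, c * y)"
| "attach Rich Rich (a, b, c) (x, y, z) = (a * (y + z), b * y, c * y)"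

text \<open>The attached side contributes at least its smallest size over all three families:
  \<open>m\<close> for \<open>Needy\<close> and \<open>Rich\<close>, \<open>Suc m\<close> for
  \<open>Even\<close>.\<close>

definition attach_order :: "kind \<Rightarrow> nat \<Rightarrow> nat \<Rightarrow> nat" where
  "attach_order Y n m = n + m + (if Y = Even then 1 else 0)"

text \<open>In each of the nine cases, every convolution either vanishes at the size in question or
  is the product of its lowest terms.\<close>

lemma profile_attach:
  assumes "profile X n i d u t" "profile Y m i' d' u' t'"
  shows "profile (attach_kind X Y) (attach_order Y n m)
    (conv i (\<lambda>k. i' k + d' k + u' k))
    (\<lambda>k. conv d (\<lambda>k. i' k + d' k) k + conv u i' k)
    (conv u d') (attach X Y t t')"
proof -
  obtain a b c where t: "t = (a, b, c)" by (cases t)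
  obtain x y z where t': "t' = (x, y, z)" by (cases t')
  \<comment> \<open>\<open>L f p\<close> says that \<open>f\<close> vanishes below \<open>p\<close>;
    the largest known \<open>p\<close> for each factor is fed to \<open>low0\<close> and
    \<open>low\<close>.\<close>
  define L where "L f p \<longleftrightarrow> (\<forall>j<p. f j = 0)" for f :: "nat \<Rightarrow> nat" and p
  have low0: "conv f g k = 0" if "L f p" "L g q" "k < p + q" for f g p q k
    using that conv_eq_0[of p f q g k] by (auto simp: L_def)
  have low: "conv f g k = f p * g q" if "L f p" "L g q" "k = p + q" for f g p q k
    using that conv_lowest[of p f q g k] by (auto simp: L_def)
  have i: "L i (Suc n)" and d: "L d n" and u: "L u n"
    using assms(1) by (auto simp: profile_def t L_def less_Suc_eq_le)
  have i': "L i' (Suc m)" and d': "L d' m" and u': "L u' m"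
    using assms(2) by (auto simp: profile_def t' L_def less_Suc_eq_le)
  \<comment> \<open>The kind raises a threshold by one where the value at size \<open>n\<close> is
    known to vanish.\<close>
  have d1: "L d (Suc n)" if "X \<noteq> Rich"
    using assms(1) that by (auto simp: profile_def t L_def less_Suc_eq split: kind.splits)
  have u1: "L u (Suc n)" if "X = Even"
    using assms(1) that by (auto simp: profile_def t L_def less_Suc_eq split: kind.splits)
  have d1': "L d' (Suc m)" if "Y \<noteq> Rich"
    using assms(2) that by (auto simp: profile_def t' L_def less_Suc_eq split: kind.splits)
  have u1': "L u' (Suc m)" if "Y = Even"
    using assms(2) that by (auto simp: profile_def t' L_def less_Suc_eq split: kind.splits)
  have s: "L (\<lambda>k. i' k + d' k) m" "L (\<lambda>k. i' k + d' k + u' k) m"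
    using i' d' u' by (auto simp: L_def)
  have s1: "L (\<lambda>k. i' k + d' k) (Suc m)" if "Y \<noteq> Rich" using i' d1'[OF that] by (auto simp: L_def)
  have s2: "L (\<lambda>k. i' k + d' k + u' k) (Suc m)" if "Y = Even"
    using i' d1' u1' that by (auto simp: L_def)
  note A = assms[unfolded profile_def t t']
  show ?thesis
  proof (cases X; cases Y)
    assume k: "X = Needy" "Y = Needy"
    show ?thesis using A unfolding profile_def k attach_order_def t t'
      by (simp add: low0[OF i s(2)] low[OF i s(2)] low0[OF d1 s1] low[OF d1 s1] low0[OF u i'] low[OF u i']
        low0[OF u d1'] low[OF u d1'] k)
  next
    assume k: "X = Needy" "Y = Even"
    show ?thesis using A unfolding profile_def k attach_order_def t t'
      by (simp add: low0[OF i s2] low[OF i s2] low0[OF d1 s1] low[OF d1 s1] low0[OF u i'] low[OF u i']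
        low0[OF u d1'] low[OF u d1'] k)
  next
    assume k: "X = Needy" "Y = Rich"
    show ?thesis using A unfolding profile_def k attach_order_def t t'
      by (simp add: low0[OF i s(2)] low[OF i s(2)] low0[OF d1 s(1)] low[OF d1 s(1)] low0[OF u i'] low[OF u i']
        low0[OF u d'] low[OF u d'] k)
  next
    assume k: "X = Even" "Y = Needy"
    show ?thesis using A unfolding profile_def k attach_order_def t t'
      by (simp add: low0[OF i s(2)] low[OF i s(2)] low0[OF d1 s1] low0[OF u1 i'] low0[OF u1 d1'] k)
  next
    assume k: "X = Even" "Y = Even"
    show ?thesis using A unfolding profile_def k attach_order_def t t'
      by (simp add: low0[OF i s2] low[OF i s2] low0[OF d1 s1] low[OF d1 s1] low0[OF u1 i'] low[OF u1 i']
        low0[OF u1 d1'] low[OF u1 d1'] k)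
  next
    assume k: "X = Even" "Y = Rich"
    show ?thesis using A unfolding profile_def k attach_order_def t t'
      by (simp add: low0[OF i s(2)] low[OF i s(2)] low0[OF d1 s(1)] low[OF d1 s(1)] low0[OF u1 i'] low[OF u1 i']
        low0[OF u1 d'] low[OF u1 d'] k)
  next
    assume k: "X = Rich" "Y = Needy"
    show ?thesis using A unfolding profile_def k attach_order_def t t'
      by (simp add: low0[OF i s(2)] low[OF i s(2)] low0[OF d s1] low[OF d s1] low0[OF u i'] low[OF u i']
        low0[OF u d1'] low[OF u d1'] k)
  next
    assume k: "X = Rich" "Y = Even"
    show ?thesis using A unfolding profile_def k attach_order_def t t'
      by (simp add: low0[OF i s2] low[OF i s2] low0[OF d s1] low[OF d s1] low0[OF u i'] low[OF u i']
        low0[OF u d1'] low[OF u d1'] k)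
  next
    assume k: "X = Rich" "Y = Rich"
    show ?thesis using A unfolding profile_def k attach_order_def t t'
      by (simp add: low0[OF i s(2)] low[OF i s(2)] low0[OF d s(1)] low[OF d s(1)] low0[OF u i'] low[OF u i']
        low0[OF u d'] low[OF u d'] k)
  qed
qed

section \<open>A finite table closed under attaching\<close>

text \<open>An entry \<open>(X, k, a, b, c)\<close> stands for the bounds \<open>a / sqrt 5 ^ k\<close>, \<open>b / sqrt 5 ^ k\<close>,
  \<open>c / sqrt 5 ^ k\<close> on the three counts of a profile of kind \<open>X\<close> divided by \<open>sqrt 5 ^ n\<close>; comparisons
  are made after squaring, hence in integers. The entries were found by computer search, closing
  the profile of a single vertex under attaching and merging entries where that was harmless.\<close>

definition table :: "(kind \<times> nat \<times> int \<times> int \<times> int) list" where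
  "table = [
    (Needy, 0, 1, 0, 1),
    (Needy, 1, 2, 2, 1),
    (Needy, 3, 9, 9, 7),
    (Needy, 5, 41, 56, 23),
    (Even, 0, 1, 1, 0),
    (Even, 1, 1, 2, 2),
    (Even, 2, 2, 6, 3),
    (Even, 3, 4, 15, 3),
    (Even, 3, 6, 13, 2),
    (Even, 3, 7, 9, 9),
    (Even, 4, 14, 27, 9),
    (Even, 5, 23, 41, 56),
    (Rich, 1, 2, 1, 1),
    (Rich, 2, 4, 3, 1),
    (Rich, 2, 5, 1, 2),
    (Rich, 3, 8, 7, 1),
    (Rich, 3, 10, 2, 7),
    (Rich, 3, 11, 2, 6),
    (Rich, 4, 21, 6, 13),
    (Rich, 4, 25, 7, 9),
    (Rich, 5, 50, 14, 27)]"

text \<open>Integer form of \<open>a / sqrt 5 ^ k \<le> b / sqrt 5 ^ l\<close>, cross-multiplied and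
  squared; \<open>0 \<le> b\<close> makes it sufficient for either sign of \<open>a\<close>.\<close>

definition sq_le :: "nat \<Rightarrow> nat \<Rightarrow> int \<Rightarrow> int \<Rightarrow> bool" where
  "sq_le k l a b \<longleftrightarrow> 0 \<le> b \<and> a * a * 5 ^ l \<le> b * b * 5 ^ k"

fun entry_le :: "kind \<times> nat \<times> int \<times> int \<times> int \<Rightarrow> kind \<times> nat \<times> int \<times> int \<times> int \<Rightarrow> bool" where
  "entry_le (X, k, a, b, c) (Y, l, x, y, z) \<longleftrightarrow> X = Y \<and> sq_le k l a x \<and> sq_le k l b y \<and> sq_le k l c z"

text \<open>The exponents follow \<open>attach_order\<close> as well: an \<open>Even\<close>
  attached side raises the order by one more, so normalized counts lose a further factor
  \<open>sqrt 5\<close>.\<close>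

fun attach_entry :: "kind \<times> nat \<times> int \<times> int \<times> int \<Rightarrow> kind \<times> nat \<times> int \<times> int \<times> int
    \<Rightarrow> kind \<times> nat \<times> int \<times> int \<times> int" where
  "attach_entry (X, k, t) (Y, l, t') = (attach_kind X Y, attach_order Y k l, attach X Y t t')"

text \<open>The desired bound after normalization: \<open>b / sqrt 5 ^ k \<le> 1\<close> when the
  domination number is the order (\<open>Rich\<close>),
  \<open>(a + b) / sqrt 5 ^ k \<le> sqrt 5\<close> when it is one more.\<close>

fun admissible :: "kind \<times> nat \<times> int \<times> int \<times> int \<Rightarrow> bool" where
  "admissible (X, k, a, b, c) \<longleftrightarrow>
    (if X = Rich then sq_le k 0 b 1 else (a + b) * (a + b) \<le> 5 ^ Suc k)"

text \<open>Evaluation finds an entry above the joined one for each of the 441 pairs.\<close>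

lemma table_closed: "\<forall>p\<in>set table. \<forall>q\<in>set table. \<exists>r\<in>set table. entry_le (attach_entry p q) r"
  by code_simp

lemma table_admissible: "\<forall>p\<in>set table. admissible p"
  by code_simp


section \<open>Real bounds on counts from table entries\<close>

definition bnd :: "nat \<Rightarrow> nat \<Rightarrow> nat \<Rightarrow> int \<Rightarrow> bool" where
  "bnd n x k a \<longleftrightarrow> real x \<le> of_int a / sqrt 5 ^ k * sqrt 5 ^ n"

definition bnd3 :: "nat \<Rightarrow> nat \<times> nat \<times> nat \<Rightarrow> nat \<Rightarrow> int \<times> int \<times> int \<Rightarrow> bool" where
  "bnd3 n = (\<lambda>(x, y, z) k (a, b, c). bnd n x k a \<and> bnd n y k b \<and> bnd n z k c)"

lemma bnd_add: "bnd n x k a \<Longrightarrow> bnd n y k b \<Longrightarrow> bnd n (x + y) k (a + b)"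
  by (simp add: bnd_def add_divide_distrib distrib_right)

lemma bnd_Suc: "bnd n x k a \<Longrightarrow> bnd (Suc n) x (Suc k) a"
  by (simp add: bnd_def)

lemma bnd_0: "bnd n 0 k 0"
  by (simp add: bnd_def)

lemma bnd_mult:
  assumes "bnd n x k a" "bnd m y l b"
  shows "bnd (n + m) (x * y) (k + l) (a * b)"
proof -
  have "real x * real y \<le> (of_int a / sqrt 5 ^ k * sqrt 5 ^ n) * (of_int b / sqrt 5 ^ l * sqrt 5 ^ m)"
    \<comment> \<open>The upper bounds are nonnegative because they lie above natural
      numbers.\<close>
    using assms unfolding bnd_def by (intro mult_mono) (auto intro: order_trans[of 0 "real x"])
  then show ?thesis by (simp add: bnd_def power_add field_simps)
qed

text \<open>Undoes the squaring: since \<open>5 ^ j\<close> is the square of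
  \<open>sqrt 5 ^ j\<close>, the integer inequality compares two squares, and the larger one has a
  nonnegative root.\<close>

lemma bnd_sq_le:
  assumes "bnd n x k a" "sq_le k l a b"
  shows "bnd n x l b"
proof -
  have "real_of_int (a * a * 5 ^ l) \<le> real_of_int (b * b * 5 ^ k)"
    using assms(2) unfolding sq_le_def by (simp only: of_int_le_iff)
  moreover have "(5::real) ^ j = (sqrt 5 ^ j)\<^sup>2" for j
    by (simp add: power_mult[symmetric] mult.commute[of j]) (simp add: power_mult)
  ultimately have "(real_of_int a * sqrt 5 ^ l)\<^sup>2 \<le> (real_of_int b * sqrt 5 ^ k)\<^sup>2"
    by (simp add: power_mult_distrib power2_eq_square mult_ac)
  then have "real_of_int a * sqrt 5 ^ l \<le> real_of_int b * sqrt 5 ^ k"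
    by (rule power2_le_imp_le) (use assms(2) in \<open>simp add: sq_le_def\<close>)
  then have "real_of_int a / sqrt 5 ^ k \<le> real_of_int b / sqrt 5 ^ l"
    by (simp add: field_simps)
  then have "real_of_int a / sqrt 5 ^ k * sqrt 5 ^ n \<le> real_of_int b / sqrt 5 ^ l * sqrt 5 ^ n"
    by (rule mult_right_mono) simp
  with assms(1) show ?thesis unfolding bnd_def by (rule order_trans)
qed

text \<open>\<open>attach\<close> uses only sums and products, so upper bounds propagate; for
  \<open>Y = Even\<close>, \<open>bnd_Suc\<close> raises order and exponent together.\<close>

lemma bnd3_attach:
  assumes "bnd3 n t k e" "bnd3 m t' l e'"
  shows "bnd3 (attach_order Y n m) (attach X Y t t') (attach_order Y k l) (attach X Y e e')"
proof -
  obtain a b c where t: "t = (a, b, c)" by (cases t)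
  obtain x y z where t': "t' = (x, y, z)" by (cases t')
  obtain a' b' c' where e: "e = (a', b', c')" by (cases e)
  obtain x' y' z' where e': "e' = (x', y', z')" by (cases e')
  have *: "bnd n a k a'" "bnd n b k b'" "bnd n c k c'" "bnd m x l x'" "bnd m y l y'" "bnd m z l z'"
    using assms by (auto simp: bnd3_def t t' e e')
  show ?thesis
    unfolding t t' e e' attach_order_def bnd3_def
    by (cases X; cases Y) (simp_all add: * bnd_add bnd_mult bnd_Suc bnd_0)
qed

definition covered :: "kind \<Rightarrow> nat \<Rightarrow> nat \<times> nat \<times> nat \<Rightarrow> bool" where
  "covered X n t \<longleftrightarrow> (\<exists>k e. (X, k, e) \<in> set table \<and> bnd3 n t k e)"

text \<open>\<open>table_closed\<close> replaces the joined bounds by a table entry above them,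
  which makes lying below the table an invariant of attaching.\<close>

lemma covered_attach:
  assumes "covered X n t" "covered Y m t'"
  shows "covered (attach_kind X Y) (attach_order Y n m) (attach X Y t t')"
proof -
  obtain k e l e' where e: "(X, k, e) \<in> set table" "bnd3 n t k e" "(Y, l, e') \<in> set table" "bnd3 m t' l e'"
    using assms by (auto simp: covered_def)
  then obtain r where r: "r \<in> set table" "entry_le (attach_entry (X, k, e) (Y, l, e')) r"
    using table_closed by blast
  obtain a b c where abc: "attach X Y e e' = (a, b, c)" by (cases "attach X Y e e'")
  obtain Z j x y z where r': "r = (Z, j, x, y, z)" by (cases r)
  obtain u v w where uvw: "attach X Y t t' = (u, v, w)" by (cases "attach X Y t t'")
  have "bnd3 (attach_order Y n m) (u, v, w) (attach_order Y k l) (a, b, c)"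
    using bnd3_attach[OF e(2,4), of Y X] by (simp add: abc uvw)
  then have "bnd3 (attach_order Y n m) (u, v, w) j (x, y, z)"
    using r by (auto simp: bnd3_def r' abc intro: bnd_sq_le)
  then show ?thesis using r by (auto simp: covered_def r' abc uvw)
qed

text \<open>The first table entry serves not only a single vertex but an isolated root added to any
  forest that satisfies the bound.\<close>

lemma covered_Needy_bnd: "real N \<le> sqrt 5 ^ n \<Longrightarrow> covered Needy n (N, 0, N)"
  unfolding covered_def by (rule exI[of _ 0], rule exI[of _ "(1, 0, 1)"])
    (simp add: table_def bnd3_def bnd_def)

lemma covered_bound:
  assumes "covered X n (a, b, c)"
  shows "if X = Rich then real b \<le> sqrt 5 ^ n else real (a + b) \<le> sqrt 5 ^ Suc n"
proof -
  obtain k x y z where e: "(X, k, x, y, z) \<in> set table" "bnd3 n (a, b, c) k (x, y, z)"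
    using assms by (auto simp: covered_def)
  have adm: "admissible (X, k, x, y, z)" using table_admissible e by blast
  have b: "bnd n b k y" "bnd n (a + b) k (x + y)" using e by (auto simp: bnd3_def intro: bnd_add)
  show ?thesis
  proof (cases "X = Rich")
    case True
    then have "bnd n b 0 1" using adm b by (auto intro: bnd_sq_le)
    then show ?thesis using True by (simp add: bnd_def)
  next
    case False
    \<comment> \<open>The extra \<open>sqrt 5\<close> allowed at domination number
      \<open>Suc n\<close> becomes the exponent \<open>Suc k\<close> in the denominator.\<close>
    then have "sq_le (Suc k) 0 (x + y) 1" using adm by (simp add: sq_le_def)
    then have "bnd (Suc n) (a + b) 0 1" using bnd_Suc[OF b(2)] by (rule bnd_sq_le[rotated])
    then show ?thesis using False by (simp add: bnd_def)
  qed
qed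

section \<open>Splitting a forest at an edge\<close>

lemma sub_forest:
  assumes "forest V E" "V1 \<subseteq> V"
  shows "forest V1 {e \<in> E. e \<subseteq> V1}"
proof -
  have "\<not> is_cycle V1 {e \<in> E. e \<subseteq> V1} c" for c
  proof
    assume "is_cycle V1 {e \<in> E. e \<subseteq> V1} c"
    then have "is_cycle V E c" using assms(2) by (auto simp: is_cycle_def)
    then show False using assms(1) by (auto simp: forest_def)
  qed
  then show ?thesis using assms by (auto simp: forest_def simple_graph_def intro: finite_subset)
qed

lemma rtrancl_distinct_path:
  assumes "(x, y) \<in> R\<^sup>*"
  obtains p where "p \<noteq> []" "hd p = x" "last p = y" "distinct p"
    "\<And>i. i < length p - 1 \<Longrightarrow> (p ! i, p ! Suc i) \<in> R"
proof -
  have "\<exists>p. p \<noteq> [] \<and> hd p = x \<and> last p = y \<and> distinct p \<and> (\<forall>i < length p - 1. (p ! i, p ! Suc i) \<in> R)"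
    using assms
  proof (induction rule: rtrancl_induct)
    case base
    show ?case by (rule exI[of _ "[x]"]) simp
  next
    case (step y z)
    then obtain p where p: "p \<noteq> []" "hd p = x" "last p = y" "distinct p"
      "\<forall>i < length p - 1. (p ! i, p ! Suc i) \<in> R" by blast
    show ?case
    proof (cases "z \<in> set p")
      case True
      then obtain j where j: "j < length p" "p ! j = z" by (auto simp: in_set_conv_nth)
      \<comment> \<open>If \<open>z\<close> was already visited, the path is cut there instead of
        extended.\<close>
      let ?q = "take (Suc j) p"
      have "last ?q = z" using j by (simp add: take_Suc_conv_app_nth)
      moreover have "hd ?q = x" using p by simp
      ultimately show ?thesis using p j by (intro exI[of _ ?q]) auto
    next
      case False
      have "((p @ [z]) ! i, (p @ [z]) ! Suc i) \<in> R" if "i < length (p @ [z]) - 1" for i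
      proof (cases "i < length p - 1")
        case True
        then have "i < length p" "Suc i < length p" by auto
        then show ?thesis using True p(5) by (simp only: nth_append if_True)
      next
        case False
        then have i: "i = length p - 1" "Suc i = length p" using that p(1) by (auto simp: Suc_le_eq)
        then have "p ! i = y" using p by (simp add: last_conv_nth)
        then show ?thesis using i step(2) by (simp add: nth_append)
      qed
      then show ?thesis using p False by (intro exI[of _ "p @ [z]"]) auto
    qed
  qed
  then show ?thesis using that by blast
qed

text \<open>\<open>V1\<close> is the component of \<open>r\<close> after deleting the edge,
  \<open>V2\<close> everything else, other components included. A path from \<open>r\<close> to
  \<open>s\<close> avoiding the edge would close with it to a cycle.\<close>

lemma forest_split_edge:
  assumes "forest V E" "{r, s} \<in> E"
  obtains V1 V2 where "V = V1 \<union> V2" "V1 \<inter> V2 = {}" "r \<in> V1" "s \<in> V2"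
    "\<And>e. e \<in> E \<Longrightarrow> e \<subseteq> V1 \<or> e \<subseteq> V2 \<or> e = {r, s}"
proof -
  define R where "R = {(x, y). {x, y} \<in> E \<and> {x, y} \<noteq> {r, s}}"
  define V1 where "V1 = {v \<in> V. (r, v) \<in> R\<^sup>*}"
  have E: "e \<subseteq> V" "card e = 2" if "e \<in> E" for e
    using assms(1) that by (auto simp: forest_def simple_graph_def)
  have rs: "r \<in> V" "s \<in> V" "r \<noteq> s" using E[OF assms(2)] by auto
  have "(r, s) \<notin> R\<^sup>*"
  proof
    assume "(r, s) \<in> R\<^sup>*"
    then obtain p where p: "p \<noteq> []" "hd p = r" "last p = s" "distinct p"
      "\<And>i. i < length p - 1 \<Longrightarrow> (p ! i, p ! Suc i) \<in> R"
      using rtrancl_distinct_path by metis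
    have edge: "{p ! i, p ! Suc i} \<in> E" if "i < length p - 1" for i
      using p(5)[OF that] by (simp add: R_def)
    \<comment> \<open>One vertex would force \<open>r = s\<close>; two would make the path the
      deleted edge itself.\<close>
    have len: "length p \<ge> 3"
    proof (rule ccontr)
      assume "\<not> length p \<ge> 3"
      then consider x where "p = [x]" | x y where "p = [x, y]"
        using p(1) by (cases p rule: remdups_adj.cases) (simp_all add: Suc_le_eq)
      then show False
      proof cases
        case 1
        then show False using p rs by simp
      next
        case 2
        then have "(r, s) \<in> R" using p(5)[of 0] p(2,3) by simp
        then show False by (simp add: R_def)
      qed
    qed
    have "v \<in> V" if v: "v \<in> set p" for v
    proof -
      obtain j where j: "j < length p" "v = p ! j" using v by (auto simp: in_set_conv_nth)
      show ?thesis
      proof (cases "j = length p - 1")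
        case True
        then show ?thesis using p(1,3) rs j by (simp add: last_conv_nth)
      next
        case False
        then have "{p ! j, p ! Suc j} \<in> E" using edge j(1) by simp
        then show ?thesis using E(1) j(2) by blast
      qed
    qed
    then have "set p \<subseteq> V" by blast
    moreover have "{last p, hd p} \<in> E" using assms(2) p(2,3) by (simp add: insert_commute)
    ultimately have "is_cycle V E p" using len p(4) edge unfolding is_cycle_def by blast
    then show False using assms(1) by (auto simp: forest_def)
  qed
  show ?thesis
  proof (rule that[of V1 "V - V1"])
    show "V = V1 \<union> (V - V1)" "V1 \<inter> (V - V1) = {}" "r \<in> V1" "s \<in> V - V1"
      using rs \<open>(r, s) \<notin> R\<^sup>*\<close> by (auto simp: V1_def)
    fix e assume e: "e \<in> E"
    obtain x y where xy: "e = {x, y}" using E(2)[OF e] by (auto simp: card_2_iff)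
    have "x \<in> V" "y \<in> V" using E(1)[OF e] xy by auto
    moreover have "e = {r, s} \<or> ((x, y) \<in> R \<and> (y, x) \<in> R)"
      using e by (auto simp: R_def xy insert_commute)
    ultimately show "e \<subseteq> V1 \<or> e \<subseteq> V - V1 \<or> e = {r, s}"
      by (auto simp: V1_def xy intro: rtrancl_into_rtrancl)
  qed
qed

text \<open>Only \<open>r\<close> and \<open>s\<close> gain a neighbour from the edge. If
  \<open>r\<close> is chosen, \<open>s\<close> is dominated for free and may be in any state;
  otherwise \<open>s\<close> must be chosen, which dominates \<open>r\<close>, or be dominated
  within \<open>V2\<close>.\<close>

lemma sets_split_edge:
  fixes V1 V2 :: "'a set" and E :: "'a set set"
  assumes "V1 \<inter> V2 = {}" "r \<in> V1" "s \<in> V2" "{r, s} \<in> E"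
    "\<And>e. e \<in> E \<Longrightarrow> e \<subseteq> V1 \<or> e \<subseteq> V2 \<or> e = {r, s}" "D \<subseteq> V1 \<union> V2"
  defines "E1 \<equiv> {e \<in> E. e \<subseteq> V1}" and "E2 \<equiv> {e \<in> E. e \<subseteq> V2}"
  shows "in_sets (V1 \<union> V2) E r D \<longleftrightarrow> in_sets V1 E1 r (D \<inter> V1) \<and>
      ((in_sets V2 E2 s (D \<inter> V2) \<or> dom_sets V2 E2 s (D \<inter> V2)) \<or> un_sets V2 E2 s (D \<inter> V2))"
    and "dom_sets (V1 \<union> V2) E r D \<longleftrightarrow>
      (dom_sets V1 E1 r (D \<inter> V1) \<and> (in_sets V2 E2 s (D \<inter> V2) \<or> dom_sets V2 E2 s (D \<inter> V2))) \<or>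
      (un_sets V1 E1 r (D \<inter> V1) \<and> in_sets V2 E2 s (D \<inter> V2))"
    and "un_sets (V1 \<union> V2) E r D \<longleftrightarrow> un_sets V1 E1 r (D \<inter> V1) \<and> dom_sets V2 E2 s (D \<inter> V2)"
proof -
  have nb1: "(\<exists>u\<in>D. {u, v} \<in> E) \<longleftrightarrow> (\<exists>u\<in>D \<inter> V1. {u, v} \<in> E1) \<or> (v = r \<and> s \<in> D)" if "v \<in> V1" for v
  proof -
    have "u \<in> V1 \<or> (v = r \<and> u = s)" if "{u, v} \<in> E" for u
      using assms(5)[OF that] \<open>v \<in> V1\<close> assms(1,2,3) by (auto simp: doubleton_eq_iff)
    then show ?thesis using that assms(4) unfolding E1_def by (auto simp: insert_commute)
  qed
  have nb2: "(\<exists>u\<in>D. {u, v} \<in> E) \<longleftrightarrow> (\<exists>u\<in>D \<inter> V2. {u, v} \<in> E2) \<or> (v = s \<and> r \<in> D)" if "v \<in> V2" for v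
  proof -
    have "u \<in> V2 \<or> (v = s \<and> u = r)" if "{u, v} \<in> E" for u
      using assms(5)[OF that] \<open>v \<in> V2\<close> assms(1,2,3) by (auto simp: doubleton_eq_iff)
    then show ?thesis using that assms(4) unfolding E2_def by (auto simp: insert_commute)
  qed
  have "near_dom (V1 \<union> V2) E r D \<longleftrightarrow>
      (\<forall>v\<in>V1 - {r}. v \<in> D \<or> (\<exists>u\<in>D. {u, v} \<in> E)) \<and> (\<forall>v\<in>V2. v \<in> D \<or> (\<exists>u\<in>D. {u, v} \<in> E))"
    using assms(1,2) by (auto simp: near_dom_def)
  also have "(\<forall>v\<in>V1 - {r}. v \<in> D \<or> (\<exists>u\<in>D. {u, v} \<in> E)) \<longleftrightarrow> near_dom V1 E1 r (D \<inter> V1)"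
    unfolding near_dom_def by (intro ball_cong refl) (simp add: nb1)
  also have "(\<forall>v\<in>V2. v \<in> D \<or> (\<exists>u\<in>D. {u, v} \<in> E)) \<longleftrightarrow>
      (s \<in> D \<or> (\<exists>u\<in>D. {u, s} \<in> E)) \<and> (\<forall>v\<in>V2 - {s}. v \<in> D \<or> (\<exists>u\<in>D. {u, v} \<in> E))"
    using assms(3) by auto
  also have "(\<forall>v\<in>V2 - {s}. v \<in> D \<or> (\<exists>u\<in>D. {u, v} \<in> E)) \<longleftrightarrow> near_dom V2 E2 s (D \<inter> V2)"
    unfolding near_dom_def by (intro ball_cong refl) (simp add: nb2)
  finally have near: "near_dom (V1 \<union> V2) E r D \<longleftrightarrow> near_dom V1 E1 r (D \<inter> V1) \<and>
      (s \<in> D \<inter> V2 \<or> (\<exists>u\<in>D \<inter> V2. {u, s} \<in> E2) \<or> r \<in> D \<inter> V1) \<and> near_dom V2 E2 s (D \<inter> V2)"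
    using nb2[OF assms(3)] assms(2,3) by simp
  have root: "(\<exists>u\<in>D. {u, r} \<in> E) \<longleftrightarrow> (\<exists>u\<in>D \<inter> V1. {u, r} \<in> E1) \<or> s \<in> D \<inter> V2"
      "r \<in> D \<longleftrightarrow> r \<in> D \<inter> V1"
    using nb1[OF assms(2)] assms(2,3) by auto
  show "in_sets (V1 \<union> V2) E r D \<longleftrightarrow> in_sets V1 E1 r (D \<inter> V1) \<and>
      ((in_sets V2 E2 s (D \<inter> V2) \<or> dom_sets V2 E2 s (D \<inter> V2)) \<or> un_sets V2 E2 s (D \<inter> V2))"
    unfolding in_sets_def dom_sets_def un_sets_def near root by argo
  show "dom_sets (V1 \<union> V2) E r D \<longleftrightarrow>
      (dom_sets V1 E1 r (D \<inter> V1) \<and> (in_sets V2 E2 s (D \<inter> V2) \<or> dom_sets V2 E2 s (D \<inter> V2))) \<or>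
      (un_sets V1 E1 r (D \<inter> V1) \<and> in_sets V2 E2 s (D \<inter> V2))"
    unfolding in_sets_def dom_sets_def un_sets_def near root by argo
  show "un_sets (V1 \<union> V2) E r D \<longleftrightarrow> un_sets V1 E1 r (D \<inter> V1) \<and> dom_sets V2 E2 s (D \<inter> V2)"
    unfolding in_sets_def dom_sets_def un_sets_def near root by argo
qed


section \<open>The bound\<close>

lemma count_eq_0_iff: "finite V \<Longrightarrow> count V P k = 0 \<longleftrightarrow> (\<forall>D\<subseteq>V. P D \<longrightarrow> card D \<noteq> k)"
  unfolding count_def by (subst card_0_eq) (auto intro: finite_subset[of _ "Pow V"])

lemma card_min_dom_sets: "card (min_dom_sets V E) = count V (dominating V E) (domination_number V E)"
  unfolding count_def min_dom_sets_def by (rule arg_cong[where f = card]) (auto simp: dominating_def)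

lemma domination_number_eqI:
  assumes "finite V" "\<And>k. k < m \<Longrightarrow> count V (dominating V E) k = 0" "count V (dominating V E) m > 0"
  shows "domination_number V E = m"
  unfolding domination_number_def
proof (rule Least_equality)
  have "count V (dominating V E) m \<noteq> 0" using assms(3) by simp
  then show "\<exists>D. dominating V E D \<and> card D = m"
    unfolding count_eq_0_iff[OF assms(1)] by blast
  fix k assume "\<exists>D. dominating V E D \<and> card D = k"
  then have "count V (dominating V E) k \<noteq> 0"
    unfolding count_eq_0_iff[OF assms(1)] by (auto simp: dominating_def)
  then show "m \<le> k" using assms(2)[of k] by (meson not_le)
qed

lemma count_dominating_below:
  assumes "finite V" "k < domination_number V E"
  shows "count V (dominating V E) k = 0"
  using not_less_Least[OF assms(2)[unfolded domination_number_def]]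
  unfolding count_eq_0_iff[OF assms(1)] by blast

lemma card_min_dom_sets_pos:
  assumes "finite V"
  shows "card (min_dom_sets V E) > 0"
proof -
  have "dominating V E V" by (simp add: dominating_def)
  then have "\<exists>k D. dominating V E D \<and> card D = k" by blast
  then have "\<exists>D. dominating V E D \<and> card D = domination_number V E"
    unfolding domination_number_def by (rule LeastI_ex)
  then have "count V (dominating V E) (domination_number V E) \<noteq> 0"
    unfolding count_eq_0_iff[OF assms] by (auto simp: dominating_def)
  then show ?thesis by (simp add: card_min_dom_sets)
qed

section \<open>Profiles of rooted forests\<close>

definition rooted_profile :: "'a set \<Rightarrow> 'a set set \<Rightarrow> 'a \<Rightarrow> kind \<Rightarrow> nat \<Rightarrow> nat \<times> nat \<times> nat \<Rightarrow> bool" where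
  "rooted_profile V E r X n t \<longleftrightarrow>
    profile X n (count V (in_sets V E r)) (count V (dom_sets V E r)) (count V (un_sets V E r)) t"

text \<open>Dominating sets are exactly the first two families, so a profile determines the
  domination number and the number of minimum dominating sets.\<close>

lemma rooted_profile_bound:
  assumes "finite V" "r \<in> V" "rooted_profile V E r X n t" "covered X n t"
  shows "real (card (min_dom_sets V E)) \<le> sqrt 5 ^ domination_number V E"
proof -
  obtain a b c where t: "t = (a, b, c)" by (cases t)
  have "dominating V E D \<longleftrightarrow> in_sets V E r D \<or> dom_sets V E r D" if "D \<subseteq> V" for D
    using that assms(2) by (auto simp: dominating_def in_sets_def dom_sets_def near_dom_def)
  then have "count V (dominating V E) = count V (\<lambda>D. in_sets V E r D \<or> dom_sets V E r D)"
    by (rule count_cong)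
  also have "\<dots> = (\<lambda>k. count V (in_sets V E r) k + count V (dom_sets V E r) k)"
    by (rule ext, rule count_disj) (use assms(1) in \<open>auto simp: in_sets_def dom_sets_def\<close>)
  finally have cnt: "count V (dominating V E) k = count V (in_sets V E r) k + count V (dom_sets V E r) k" for k
    by simp
  note prof = assms(3)[unfolded rooted_profile_def profile_def t]
  show ?thesis
  proof (cases "X = Rich")
    case True
    have "domination_number V E = n"
      by (rule domination_number_eqI) (use assms(1) prof True in \<open>auto simp: cnt\<close>)
    then show ?thesis using covered_bound[OF assms(4)[unfolded t]] prof True
      by (simp add: card_min_dom_sets cnt)
  next
    case False
    have "domination_number V E = Suc n"
      by (rule domination_number_eqI)
        (use assms(1) prof False in \<open>auto simp: cnt less_Suc_eq split: kind.splits\<close>)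
    then show ?thesis using covered_bound[OF assms(4)[unfolded t]] prof False
      by (auto simp: card_min_dom_sets cnt split: kind.splits)
  qed
qed

text \<open>An isolated root is either chosen or undominated, and the rest must dominate itself.
  Choosing the root only shifts sizes by one.\<close>

lemma rooted_profile_isolated:
  assumes "finite V" "r \<in> V" "\<And>e. e \<in> E \<Longrightarrow> r \<notin> e"
  shows "rooted_profile V E r Needy (domination_number (V - {r}) E)
    (card (min_dom_sets (V - {r}) E), 0, card (min_dom_sets (V - {r}) E))"
proof -
  define W where "W = V - {r}"
  have W: "finite W" "V = {r} \<union> W" "{r} \<inter> W = {}" using assms(1,2) by (auto simp: W_def)
  have root: "\<not> (\<exists>u\<in>D. {u, r} \<in> E)" for D using assms(3) by blast
  have near: "near_dom V E r D \<longleftrightarrow> dominating W E (D \<inter> W)" if "D \<subseteq> V" for D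
  proof -
    have "(\<exists>u\<in>D. {u, v} \<in> E) \<longleftrightarrow> (\<exists>u\<in>D \<inter> W. {u, v} \<in> E)" for v
      using that assms(3) unfolding W_def by blast
    then show ?thesis unfolding near_dom_def dominating_def W_def by auto
  qed
  have "count V (in_sets V E r) = count ({r} \<union> W) (\<lambda>D. r \<in> D \<inter> {r} \<and> dominating W E (D \<inter> W))"
    unfolding W(2)[symmetric] by (rule count_cong) (auto simp: in_sets_def near)
  also have "\<dots> = conv (count {r} (\<lambda>D. r \<in> D)) (count W (dominating W E))"
    by (rule count_split) (use W in auto)
  finally have i: "count V (in_sets V E r) = conv (count {r} (\<lambda>D. r \<in> D)) (count W (dominating W E))" .
  have "count V (un_sets V E r) = count ({r} \<union> W) (\<lambda>D. r \<notin> D \<inter> {r} \<and> dominating W E (D \<inter> W))"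
    unfolding W(2)[symmetric] by (rule count_cong) (auto simp: un_sets_def near root)
  also have "\<dots> = conv (count {r} (\<lambda>D. r \<notin> D)) (count W (dominating W E))"
    by (rule count_split) (use W in auto)
  finally have u: "count V (un_sets V E r) = conv (count {r} (\<lambda>D. r \<notin> D)) (count W (dominating W E))" .
  have d: "count V (dom_sets V E r) k = 0" for k
    by (simp add: count_def dom_sets_def root)
  have "{D. D \<subseteq> {r} \<and> r \<in> D \<and> card D = 1} = {{r}}" "{D. D \<subseteq> {r} \<and> r \<notin> D \<and> card D = 0} = {{}}"
    by auto
  then have one: "count {r} (\<lambda>D. r \<in> D) 1 = 1" "count {r} (\<lambda>D. r \<notin> D) 0 = 1"
    by (simp_all add: count_def)
  have zero: "count {r} (\<lambda>D. r \<in> D) j = 0" if "j < 1" for j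
    using that by (auto simp: count_eq_0_iff card_gt_0_iff intro: finite_subset)
  note below = count_dominating_below[OF W(1), of _ E]
  let ?n = "domination_number W E"
  have "count V (in_sets V E r) k = 0" if "k < Suc ?n" for k
    unfolding i by (rule conv_eq_0[of 1 _ ?n]) (use that zero below in auto)
  moreover have "count V (in_sets V E r) (Suc ?n) = card (min_dom_sets W E)"
    unfolding i by (subst conv_lowest[of 1 _ ?n]) (use zero below one in \<open>auto simp: card_min_dom_sets\<close>)
  moreover have "count V (un_sets V E r) k = 0" if "k < ?n" for k
    unfolding u by (rule conv_eq_0[of 0 _ ?n]) (use that below in auto)
  moreover have "count V (un_sets V E r) ?n = card (min_dom_sets W E)"
    unfolding u by (subst conv_lowest[of 0 _ ?n]) (use below one in \<open>auto simp: card_min_dom_sets\<close>)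
  ultimately show ?thesis
    using card_min_dom_sets_pos[OF W(1), of E] d
    by (simp add: rooted_profile_def profile_def W_def[symmetric] less_Suc_eq_le)
qed

text \<open>\<open>sets_split_edge\<close> in terms of counts: disjoint alternatives give sums,
  conditions on the two sides give convolutions.\<close>

lemma rooted_profile_attach:
  fixes V1 V2 :: "'a set" and E :: "'a set set"
  assumes "finite V1" "finite V2" "V1 \<inter> V2 = {}" "r \<in> V1" "s \<in> V2" "{r, s} \<in> E"
    "\<And>e. e \<in> E \<Longrightarrow> e \<subseteq> V1 \<or> e \<subseteq> V2 \<or> e = {r, s}"
    "rooted_profile V1 {e \<in> E. e \<subseteq> V1} r X n t" "rooted_profile V2 {e \<in> E. e \<subseteq> V2} s Y m t'"
  shows "rooted_profile (V1 \<union> V2) E r (attach_kind X Y) (attach_order Y n m) (attach X Y t t')"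
proof -
  let ?I = "in_sets V1 {e \<in> E. e \<subseteq> V1} r" and ?I' = "in_sets V2 {e \<in> E. e \<subseteq> V2} s"
  let ?D = "dom_sets V1 {e \<in> E. e \<subseteq> V1} r" and ?D' = "dom_sets V2 {e \<in> E. e \<subseteq> V2} s"
  let ?U = "un_sets V1 {e \<in> E. e \<subseteq> V1} r" and ?U' = "un_sets V2 {e \<in> E. e \<subseteq> V2} s"
  note split = sets_split_edge[OF assms(3-7)]
  note conv = count_split[OF assms(1-3)]
  have disj: "\<not> (in_sets W F v S \<and> dom_sets W F v S)" "\<not> (in_sets W F v S \<and> un_sets W F v S)"
    "\<not> (dom_sets W F v S \<and> un_sets W F v S)" for W F v and S :: "'a set"
    by (auto simp: in_sets_def dom_sets_def un_sets_def)
  have ID': "count V2 (\<lambda>S. ?I' S \<or> ?D' S) = (\<lambda>k. count V2 ?I' k + count V2 ?D' k)"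
    by (rule ext, rule count_disj) (use assms(2) disj in auto)
  have IDU': "count V2 (\<lambda>S. (?I' S \<or> ?D' S) \<or> ?U' S) = (\<lambda>k. count V2 ?I' k + count V2 ?D' k + count V2 ?U' k)"
    by (rule ext, subst count_disj) (use assms(2) disj ID' in auto)
  have "count (V1 \<union> V2) (in_sets (V1 \<union> V2) E r) =
      count (V1 \<union> V2) (\<lambda>S. ?I (S \<inter> V1) \<and> ((?I' (S \<inter> V2) \<or> ?D' (S \<inter> V2)) \<or> ?U' (S \<inter> V2)))"
    by (rule count_cong) (rule split(1))
  also have "\<dots> = conv (count V1 ?I) (\<lambda>k. count V2 ?I' k + count V2 ?D' k + count V2 ?U' k)"
    using conv[of ?I "\<lambda>S. (?I' S \<or> ?D' S) \<or> ?U' S"] by (simp only: IDU')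
  finally have I: "count (V1 \<union> V2) (in_sets (V1 \<union> V2) E r) = \<dots>" .
  have "count (V1 \<union> V2) (un_sets (V1 \<union> V2) E r) =
      count (V1 \<union> V2) (\<lambda>S. ?U (S \<inter> V1) \<and> ?D' (S \<inter> V2))"
    by (rule count_cong) (rule split(3))
  also have "\<dots> = conv (count V1 ?U) (count V2 ?D')"
    by (rule conv)
  finally have U: "count (V1 \<union> V2) (un_sets (V1 \<union> V2) E r) = \<dots>" .
  have "count (V1 \<union> V2) (dom_sets (V1 \<union> V2) E r) =
      count (V1 \<union> V2) (\<lambda>S. (?D (S \<inter> V1) \<and> (?I' (S \<inter> V2) \<or> ?D' (S \<inter> V2))) \<or> (?U (S \<inter> V1) \<and> ?I' (S \<inter> V2)))"
    by (rule count_cong) (rule split(2))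
  also have "\<dots> = (\<lambda>k. count (V1 \<union> V2) (\<lambda>S. ?D (S \<inter> V1) \<and> (?I' (S \<inter> V2) \<or> ?D' (S \<inter> V2))) k +
      count (V1 \<union> V2) (\<lambda>S. ?U (S \<inter> V1) \<and> ?I' (S \<inter> V2)) k)"
    by (rule ext, rule count_disj) (use assms(1,2) disj in auto)
  also have "\<dots> = (\<lambda>k. conv (count V1 ?D) (\<lambda>k. count V2 ?I' k + count V2 ?D' k) k +
      conv (count V1 ?U) (count V2 ?I') k)"
    using conv[of ?D "\<lambda>S. ?I' S \<or> ?D' S"] conv[of ?U ?I'] by (simp only: ID')
  finally have D: "count (V1 \<union> V2) (dom_sets (V1 \<union> V2) E r) = \<dots>" .
  show ?thesis
    using profile_attach[OF assms(8,9)[unfolded rooted_profile_def]]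
    by (simp only: rooted_profile_def I D U)
qed

text \<open>The empty forest has no root and is treated apart.\<close>

lemma min_dom_sets_empty_bound: "real (card (min_dom_sets {} E)) \<le> sqrt 5 ^ domination_number {} E"
proof -
  have "min_dom_sets {} E \<subseteq> {{}}" by (auto simp: min_dom_sets_def dominating_def)
  then have "real (card (min_dom_sets {} E)) \<le> 1"
    using card_mono[of "{{}}" "min_dom_sets {} E"] by simp
  also have "1 \<le> sqrt 5 ^ domination_number {} E" by (rule one_le_power) simp
  finally show ?thesis .
qed

text \<open>Strong induction on \<open>card V\<close>. At a root with a neighbour, the forest splits
  into two smaller rooted ones. An isolated root is removed; the bound for the rest, obtained from
  the induction hypothesis at any of its vertices, starts again from the first table entry.\<close>

lemma forest_rooted_profile:
  assumes "forest V E" "r \<in> V"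
  shows "\<exists>X n t. rooted_profile V E r X n t \<and> covered X n t"
  using assms
proof (induction "card V" arbitrary: V E r rule: less_induct)
  case less
  have fin: "finite V" and E: "\<And>e. e \<in> E \<Longrightarrow> e \<subseteq> V \<and> card e = 2"
    using less.prems(1) by (auto simp: forest_def simple_graph_def)
  show ?case
  proof (cases "\<exists>e\<in>E. r \<in> e")
    case False
    define W where "W = V - {r}"
    have "{e \<in> E. e \<subseteq> W} = E" using False E by (auto simp: W_def)
    then have W: "finite W" "card W < card V" "forest W E"
      using sub_forest[OF less.prems(1), of W] fin card_Diff1_less[OF fin less.prems(2)]
      by (simp_all add: W_def)
    have "real (card (min_dom_sets W E)) \<le> sqrt 5 ^ domination_number W E"
    proof (cases "W = {}")
      case True
      then show ?thesis by (simp only: min_dom_sets_empty_bound)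
    next
      case False
      then obtain s where "s \<in> W" by blast
      then obtain X n t where "rooted_profile W E s X n t" "covered X n t"
        using less.hyps[OF W(2,3)] by blast
      then show ?thesis by (rule rooted_profile_bound[OF W(1) \<open>s \<in> W\<close>])
    qed
    then show ?thesis
      using rooted_profile_isolated[OF fin less.prems(2), of E] False covered_Needy_bnd[of _ "domination_number W E"]
      unfolding W_def by blast
  next
    case True
    then obtain e where e: "e \<in> E" "r \<in> e" by blast
    then obtain s where rs: "{r, s} \<in> E" using E[OF e(1)] by (auto simp: card_2_iff insert_commute)
    obtain V1 V2 where V: "V = V1 \<union> V2" "V1 \<inter> V2 = {}" "r \<in> V1" "s \<in> V2"
      "\<And>e. e \<in> E \<Longrightarrow> e \<subseteq> V1 \<or> e \<subseteq> V2 \<or> e = {r, s}"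
      using forest_split_edge[OF less.prems(1) rs] by metis
    have fin': "finite V1" "finite V2" using fin V(1) by auto
    have "card V1 < card V" "card V2 < card V"
      using V fin by (auto intro!: psubset_card_mono)
    moreover have "forest V1 {e \<in> E. e \<subseteq> V1}" "forest V2 {e \<in> E. e \<subseteq> V2}"
      using sub_forest[OF less.prems(1)] V(1) by auto
    ultimately obtain X n t Y m t' where
      p: "rooted_profile V1 {e \<in> E. e \<subseteq> V1} r X n t" "covered X n t"
        "rooted_profile V2 {e \<in> E. e \<subseteq> V2} s Y m t'" "covered Y m t'"
      using less.hyps[OF _ _ V(3)] less.hyps[OF _ _ V(4)] by meson
    have "rooted_profile V E r (attach_kind X Y) (attach_order Y n m) (attach X Y t t')"
      unfolding V(1) by (rule rooted_profile_attach[OF fin' V(2-4) rs V(5) p(1,3)])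
    then show ?thesis using covered_attach[OF p(2,4)] by blast
  qed
qed

theorem mainTheorem1:
  fixes V :: "'a set" and E :: "'a set set"
  assumes "forest V E"
  shows "real (card (min_dom_sets V E)) \<le> sqrt 5 ^ domination_number V E"
proof -
  have fin: "finite V" using assms by (simp add: forest_def simple_graph_def)
  show ?thesis
  proof (cases "V = {}")
    case True
    then show ?thesis by (simp only: min_dom_sets_empty_bound)
  next
    case False
    then obtain r where "r \<in> V" by blast
    then obtain X n t where "rooted_profile V E r X n t" "covered X n t"
      using forest_rooted_profile[OF assms] by blast
    then show ?thesis by (rule rooted_profile_bound[OF fin \<open>r \<in> V\<close>])
  qed
qed

end
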